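(* Let $\mathbf{P}=(P,\preceq_+,\preceq_-)$ be a compatible double poset. A linear function $\ell\in(\mathbb{R}^P)^*$ is rigid if and only if $\ell\in\mathbb{R}_{>0}\,\ell_C$ for some alternating chain $C$ of $\mathbf{P}$. In particular, the facets of the double order polytope $\overline{\mathcal{O}}(\mathbf{P})$ are in bijection with the alternating chains of $\mathbf{P}$.
   Context: A double poset $\mathbf{P}=(P,\preceq_+,\preceq_-)$ is a finite set $P$ with two partial orders; write $P_\sigma=(P,\preceq_\sigma)$ for $\sigma\in\{+,-\}$, and $-\sigma$ for the opposite sign. It is compatible if $P_+$ and $P_-$ have a common linear extension. For a poset $Q$, the order polytope is $\mathcal{O}(Q)=\{f:Q\to\mathbb{R} : 0\le f(a)\le f(b)\le 1 \text{ whenever } a\preceq b\}$. The double order polytope is $\overline{\mathcal{O}}(\mathbf{P})=\operatorname{conv}\big((2\mathcal{O}(P_+)\times\{1\})\cup(-2\mathcal{O}(P_-)\times\{-1\})\big)\subset\mathbb{R}^P\times\mathbb{R}$. For a linear function $\ell(f)=\sum_{a\in P}\ell_a f(a)$ on $\mathbb{R}^P$ let $\mathcal{O}(Q)^\ell$ be the face of $\mathcal{O}(Q)$ on which $\ell$ is maximized; for a nonempty face $F$ of $\mathcal{O}(Q)$ its normal cone is $N_Q(F)=\{\ell : F\subseteq\mathcal{O}(Q)^\ell\}$. A linear function $\ell$ is called rigid if there is a pair of faces $F_+\subseteq\mathcal{O}(P_+)$, $F_-\subseteq\mathcal{O}(P_-)$ with $\operatorname{relint}N_{P_+}(F_+)\cap\operatorname{relint}(-N_{P_-}(F_-))=\mathbb{R}_{>0}\cdot\ell$.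 Let $\hat P_\sigma$ be $P_\sigma$ with a new minimum $\hat 0$ and a new maximum $\hat 1$ adjoined (the same symbols for both signs). An alternating chain $C$ is a sequence of distinct elements $\hat0=p_0\prec_\sigma p_1\prec_{-\sigma}p_2\prec_\sigma\cdots p_k=\hat1$ (relations alternating in sign, taken in $\hat P_\pm$), together with the sign $\sigma\in\{+,-\}$ of the first relation; its linear function is $\ell_C(f)=\sigma\sum_{i=1}^{k-1}(-1)^i f(p_i)$ (interpreting $\sigma$ as $\pm1$). *)

theory Defs
  imports "HOL-Analysis.Analysis"
begin

datatype sign = Plus | Minus

fun opp :: "sign \<Rightarrow> sign" where
  "opp Plus = Minus"
| "opp Minus = Plus"

fun sign_val :: "sign \<Rightarrow> real" where
  "sign_val Plus = 1"
| "sign_val Minus = - 1"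

text \<open>
  The ground set of a (double) poset is the whole finite type \<open>'a\<close>, so that
  \<open>\<real>\<^sup>P\<close> is \<open>real ^ 'a\<close>. A linear function \<open>\<ell>(f) = \<Sum>a. \<ell>\<^sub>a f(a)\<close> is represented by its
  coefficient vector \<open>l :: real ^ 'a\<close>; its value at \<open>f\<close> is \<open>l \<bullet> f\<close>.
\<close>

type_synonym 'a double_poset = "sign \<Rightarrow> 'a rel"

definition double_poset :: "'a::finite double_poset \<Rightarrow> bool" where
  "double_poset P \<longleftrightarrow> (\<forall>\<sigma>. partial_order_on UNIV (P \<sigma>))"

definition compatible :: "'a::finite double_poset \<Rightarrow> bool" where
  "compatible P \<longleftrightarrow> (\<exists>L. linear_order_on UNIV L \<and> P Plus \<subseteq> L \<and> P Minus \<subseteq> L)"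

definition order_polytope :: "'a::finite rel \<Rightarrow> (real ^ 'a) set" where
  "order_polytope r = {f. \<forall>(a, b) \<in> r. 0 \<le> f $ a \<and> f $ a \<le> f $ b \<and> f $ b \<le> 1}"

definition double_order_polytope :: "'a::finite double_poset \<Rightarrow> ((real ^ 'a) \<times> real) set" where
  "double_order_polytope P =
     convex hull (((\<lambda>f. 2 *\<^sub>R f) ` order_polytope (P Plus)) \<times> {1} \<union>
                  ((\<lambda>f. - 2 *\<^sub>R f) ` order_polytope (P Minus)) \<times> {- 1})"

definition max_face :: "'a::finite rel \<Rightarrow> real ^ 'a \<Rightarrow> (real ^ 'a) set" where
  "max_face r l = {f \<in> order_polytope r. \<forall>g \<in> order_polytope r. l \<bullet> g \<le> l \<bullet> f}"

definition normal_cone :: "'a::finite rel \<Rightarrow> (real ^ 'a) set \<Rightarrow> (real ^ 'a) set" where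
  "normal_cone r F = {l. F \<subseteq> max_face r l}"

text \<open>For \<open>l = 0\<close> the open ray on the right-hand side is \<open>{0}\<close>, so \<open>0\<close> may be rigid.\<close>

definition rigid :: "'a::finite double_poset \<Rightarrow> real ^ 'a \<Rightarrow> bool" where
  "rigid P l \<longleftrightarrow>
     (\<exists>F G. F face_of order_polytope (P Plus) \<and> F \<noteq> {} \<and>
            G face_of order_polytope (P Minus) \<and> G \<noteq> {} \<and>
            rel_interior (normal_cone (P Plus) F) \<inter>
              rel_interior (uminus ` normal_cone (P Minus) G) = {c *\<^sub>R l | c. c > 0})"

datatype 'a hat = Hat0 | Elem 'a | Hat1

definition hat_le :: "'a rel \<Rightarrow> 'a hat \<Rightarrow> 'a hat \<Rightarrow> bool" where
  "hat_le r x y \<longleftrightarrow>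
     x = Hat0 \<or> y = Hat1 \<or> (\<exists>a b. x = Elem a \<and> y = Elem b \<and> (a, b) \<in> r)"

definition hat_less :: "'a rel \<Rightarrow> 'a hat \<Rightarrow> 'a hat \<Rightarrow> bool" where
  "hat_less r x y \<longleftrightarrow> hat_le r x y \<and> x \<noteq> y"

text \<open>
  The pair \<open>(\<sigma>, [p\<^sub>0, \<dots>, p\<^sub>k])\<close> stands for \<open>p\<^sub>0 \<prec>\<^sub>\<sigma> p\<^sub>1 \<prec>\<^bsub>-\<sigma>\<^esub> p\<^sub>2 \<prec>\<^sub>\<sigma> \<dots> p\<^sub>k\<close>. The case \<open>k = 1\<close> is
  included and yields two chains, one for each sign, both with linear function \<open>0\<close>.
\<close>

definition alternating_chains :: "'a::finite double_poset \<Rightarrow> (sign \<times> 'a hat list) set" where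
  "alternating_chains P =
     {(\<sigma>, ps). ps \<noteq> [] \<and> hd ps = Hat0 \<and> last ps = Hat1 \<and> distinct ps \<and>
        (\<forall>i. Suc i < length ps \<longrightarrow>
           hat_less (P (if even i then \<sigma> else opp \<sigma>)) (ps ! i) (ps ! Suc i))}"

text \<open>
  The coefficient vector of \<open>f \<mapsto> f(p)\<close>. The values at \<open>Hat0\<close> and \<open>Hat1\<close> are irrelevant: the inner
  elements \<open>p\<^sub>1, \<dots>, p\<^bsub>k-1\<^esub>\<close> of an alternating chain are distinct from both.
\<close>

fun coord :: "'a::finite hat \<Rightarrow> real ^ 'a" where
  "coord (Elem a) = axis a 1"
| "coord Hat0 = 0"
| "coord Hat1 = 0"

definition chain_function :: "sign \<times> 'a::finite hat list \<Rightarrow> real ^ 'a" where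
  "chain_function C =
     (case C of (\<sigma>, ps) \<Rightarrow>
        sign_val \<sigma> *\<^sub>R (\<Sum>i = 1..<length ps - 1. (- 1) ^ i *\<^sub>R coord (ps ! i)))"

lemma inner_coord_Elem: "coord (Elem a) \<bullet> f = f $ a"
  by (simp add: inner_axis')

end

theory Submission
  imports Defs
begin

text \<open>
  Attach to an alternating chain \<open>C\<close> the vector \<open>a\<^sub>C = (\<ell>\<^sub>C, -\<tau>\<^sub>C)\<close>, where \<open>\<tau>\<^sub>C = \<plusminus>1\<close> is the sign of the
  last relation of \<open>C\<close>. The double order polytope is \<open>{x. a\<^sub>C \<bullet> x \<le> 1 for all C}\<close>: given a point
  \<open>(y, t)\<close> of the right-hand side, the maxima of \<open>\<ell>\<^sub>C \<bullet> y\<close> over the alternating chains that end at a given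
  element are longest-path potentials, which decompose \<open>y\<close> as \<open>(1 + t) f - (1 - t) g\<close>.
  Up to a linear change of coordinates the \<open>a\<^sub>C\<close> are distinct vertices of a cube, so every inequality
  is irredundant and the facets correspond to the chains; the two chains \<open>0 \<prec> 1\<close> give top and bottom.
  A relative interior point of \<open>F - G\<close>, for a pair of faces defining a nonzero rigid \<open>\<ell>\<close>, is tight for
  some chain \<open>C\<close>, whence \<open>\<ell>\<^sub>C\<close> lies in both normal cones and spans the ray of \<open>\<ell>\<close>. Conversely, the facet
  of \<open>C\<close> is spanned by the faces of the two order polytopes on which \<open>\<ell>\<^sub>C\<close> and \<open>-\<ell>\<^sub>C\<close> are maximal, so
  only multiples of \<open>\<ell>\<^sub>C\<close> are constant on both.
\<close>

section \<open>Signs and finite types\<close>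

lemma opp_opp [simp]: "opp (opp s) = s"
  by (cases s) auto

lemma sign_val_opp [simp]: "sign_val (opp s) = - sign_val s"
  by (cases s) auto

lemma sign_val_mult_self [simp]: "sign_val s * sign_val s = 1"
  by (cases s) auto

lemma sign_val_inject [simp]: "sign_val s = sign_val s' \<longleftrightarrow> s = s'"
  by (cases s; cases s') auto

lemma finite_UNIV_sign [simp]: "finite (UNIV :: sign set)"
proof -
  have "UNIV = {Plus, Minus}"
    using sign.exhaust by auto
  then show ?thesis
    by (metis finite.emptyI finite_insert)
qed

lemma finite_UNIV_hat [simp]: "finite (UNIV :: 'a::finite hat set)"
proof -
  have "UNIV = insert Hat0 (insert Hat1 (range (Elem :: 'a \<Rightarrow> _)))"
    using hat.exhaust by auto
  then show ?thesis
    by (metis finite finite_imageI finite_insert)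
qed

section \<open>Alternating chains with an arbitrary end\<close>

definition alternating :: "'a double_poset \<Rightarrow> sign \<Rightarrow> 'a hat list \<Rightarrow> bool" where
  "alternating P \<sigma> ps \<longleftrightarrow>
     (\<forall>i. Suc i < length ps \<longrightarrow>
        hat_less (P (if even i then \<sigma> else opp \<sigma>)) (ps ! i) (ps ! Suc i))"

text \<open>These are the paths that \<open>potential\<close> maximizes over; at least one relation
  is demanded so that a last sign exists.\<close>

definition partial_chains :: "'a::finite double_poset \<Rightarrow> 'a hat \<Rightarrow> (sign \<times> 'a hat list) set" where
  "partial_chains P x =
     {(\<sigma>, ps). 2 \<le> length ps \<and> hd ps = Hat0 \<and> last ps = x \<and> alternating P \<sigma> ps}"

text \<open>The sign of the last relation \<open>p\<^bsub>k-1\<^esub> \<prec> p\<^sub>k\<close> of a chain with \<open>k + 1\<close> entries.\<close>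

definition end_sign :: "sign \<times> 'a hat list \<Rightarrow> sign" where
  "end_sign C = (case C of (\<sigma>, ps) \<Rightarrow> if even (length ps) then \<sigma> else opp \<sigma>)"

text \<open>The last coordinate encodes two bounds at the heights \<open>t = \<plusminus>1\<close>:
  with \<tau> for the last sign, \<ell>_C is at most \<open>(1 + \<tau>) / 2\<close> on the order
  polytope of \<open>P Plus\<close>, and its negative at most \<open>(1 - \<tau>) / 2\<close> on
  that of \<open>P Minus\<close>.\<close>

definition facet_normal :: "sign \<times> 'a::finite hat list \<Rightarrow> (real ^ 'a) \<times> real" where
  "facet_normal C = (chain_function C, - sign_val (end_sign C))"

lemma sign_val_end_sign: "sign_val (end_sign (\<sigma>, ps)) = sign_val \<sigma> * (- 1) ^ length ps"
  by (simp add: end_sign_def)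

lemma alternating_snoc:
  assumes "alternating P \<sigma> ps" "ps \<noteq> []"
    and "hat_less (P (opp (end_sign (\<sigma>, ps)))) (last ps) x"
  shows "alternating P \<sigma> (ps @ [x])"
  unfolding alternating_def
proof (intro allI impI)
  fix i assume i: "Suc i < length (ps @ [x])"
  show "hat_less (P (if even i then \<sigma> else opp \<sigma>)) ((ps @ [x]) ! i) ((ps @ [x]) ! Suc i)"
  proof (cases "Suc i < length ps")
    case True
    then show ?thesis
      using assms(1) by (auto simp: alternating_def nth_append)
  next
    case False
    then have l: "length ps = Suc i"
      using i by auto
    then show ?thesis
      using assms(2,3) by (auto simp: end_sign_def nth_append last_conv_nth)
  qed
qed

text \<open>The first way to continue a path: a relation of the opposite sign is appended, so
  \<open>x\<close> turns from an end into an inner element and contributes its coordinate.\<close>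

lemma partial_chains_snoc:
  assumes C: "(\<sigma>, ps) \<in> partial_chains P x"
    and less: "hat_less (P (opp (end_sign (\<sigma>, ps)))) x x'"
  shows "(\<sigma>, ps @ [x']) \<in> partial_chains P x'"
    and "end_sign (\<sigma>, ps @ [x']) = opp (end_sign (\<sigma>, ps))"
    and "chain_function (\<sigma>, ps @ [x']) =
           chain_function (\<sigma>, ps) + sign_val (opp (end_sign (\<sigma>, ps))) *\<^sub>R coord x"
proof -
  have ps: "2 \<le> length ps" "hd ps = Hat0" "last ps = x" "alternating P \<sigma> ps"
    using C by (auto simp: partial_chains_def)
  then have "ps \<noteq> []"
    by auto
  then show "(\<sigma>, ps @ [x']) \<in> partial_chains P x'"
    using ps less by (auto simp: partial_chains_def intro!: alternating_snoc)
  show "end_sign (\<sigma>, ps @ [x']) = opp (end_sign (\<sigma>, ps))"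
    by (simp add: end_sign_def)
  obtain n where n: "length ps = Suc (Suc n)"
    using ps(1) by (metis Suc_le_D add_2_eq_Suc le_Suc_ex)
  have last: "ps ! Suc n = x"
    using ps n by (metis Suc_length_conv diff_Suc_1 last_conv_nth list.distinct(1))
  have "chain_function (\<sigma>, ps @ [x']) =
          sign_val \<sigma> *\<^sub>R (\<Sum>i = 1..<Suc (Suc n). (- 1) ^ i *\<^sub>R coord (ps ! i))"
    unfolding chain_function_def prod.case
    by (intro arg_cong[where f = "scaleR _"] sum.cong) (auto simp: n nth_append)
  also have "\<dots> = chain_function (\<sigma>, ps) + sign_val \<sigma> *\<^sub>R (- 1) ^ Suc n *\<^sub>R coord x"
    by (simp add: chain_function_def n last scaleR_add_right scaleR_diff_right)
  finally show "chain_function (\<sigma>, ps @ [x']) =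
      chain_function (\<sigma>, ps) + sign_val (opp (end_sign (\<sigma>, ps))) *\<^sub>R coord x"
    by (simp add: sign_val_end_sign n)
qed

lemma hat_less_trans:
  assumes "partial_order_on UNIV r" "hat_less r x y" "hat_less r y z"
  shows "hat_less r x z"
proof -
  have "trans r" "antisym r"
    using assms(1) by (auto simp: partial_order_on_def preorder_on_def)
  then show ?thesis
    using assms(2,3) unfolding hat_less_def hat_le_def
    by (auto dest: transD antisymD)
qed

text \<open>The second way: a further relation of the same sign merges with the last one by
  transitivity. Ends do not enter the chain function, which therefore stays the same.\<close>

lemma partial_chains_replace_last:
  assumes C: "(\<sigma>, ps) \<in> partial_chains P x"
    and P: "double_poset P"
    and less: "hat_less (P (end_sign (\<sigma>, ps))) x x'"
  shows "(\<sigma>, butlast ps @ [x']) \<in> partial_chains P x'"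
    and "end_sign (\<sigma>, butlast ps @ [x']) = end_sign (\<sigma>, ps)"
    and "chain_function (\<sigma>, butlast ps @ [x']) = chain_function (\<sigma>, ps)"
proof -
  define qs where "qs = butlast ps"
  have *: "2 \<le> length ps" "hd ps = Hat0" "last ps = x" "alternating P \<sigma> ps"
    using C by (auto simp: partial_chains_def)
  then have ps: "ps = qs @ [x]" "qs \<noteq> []"
    unfolding qs_def by (auto simp: append_butlast_last_id simp flip: length_greater_0_conv)
  have q: "alternating P \<sigma> qs"
    unfolding alternating_def
  proof (intro allI impI)
    fix i assume "Suc i < length qs"
    then show "hat_less (P (if even i then \<sigma> else opp \<sigma>)) (qs ! i) (qs ! Suc i)"
      using *(4)[unfolded alternating_def ps, rule_format, of i] by (simp add: nth_append)
  qed
  have sign: "opp (end_sign (\<sigma>, qs)) = end_sign (\<sigma>, ps)"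
    by (simp add: ps end_sign_def)
  have "hat_less (P (opp (end_sign (\<sigma>, qs)))) (last qs) x"
    using *(4)[unfolded alternating_def ps, rule_format, of "length qs - 1"] \<open>qs \<noteq> []\<close>
    by (cases "length qs") (auto simp: end_sign_def nth_append last_conv_nth)
  then have "hat_less (P (opp (end_sign (\<sigma>, qs)))) (last qs) x'"
    using P less hat_less_trans unfolding sign double_poset_def by metis
  then have "alternating P \<sigma> (qs @ [x'])"
    using q \<open>qs \<noteq> []\<close> by (intro alternating_snoc)
  then show "(\<sigma>, butlast ps @ [x']) \<in> partial_chains P x'"
    using * ps by (auto simp: partial_chains_def Suc_le_eq)
  show "end_sign (\<sigma>, butlast ps @ [x']) = end_sign (\<sigma>, ps)"
    by (simp add: ps end_sign_def)
  show "chain_function (\<sigma>, butlast ps @ [x']) = chain_function (\<sigma>, ps)"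
    unfolding chain_function_def prod.case
    by (intro arg_cong[where f = "scaleR _"] sum.cong) (auto simp: ps nth_append)
qed

section \<open>The common linear extension and finiteness of the set of chains\<close>

locale compatible_double_poset =
  fixes P :: "'a::finite double_poset"
  assumes double_poset: "double_poset P" and compatible: "compatible P"
begin

lemma partial_order: "partial_order_on UNIV (P \<sigma>)"
  using double_poset by (simp add: double_poset_def)

text \<open>An element is ranked by the number of elements below it in the common linear extension,
  itself included; this leaves rank \<open>0\<close> to \<open>Hat0\<close>, and \<open>Hat1\<close>
  goes above the largest rank.\<close>

lemma rank_exists:
  "\<exists>r :: 'a hat \<Rightarrow> nat. inj r \<and> (\<forall>\<sigma> x y. hat_less (P \<sigma>) x y \<longrightarrow> r x < r y)"
proof -
  obtain L where L: "linear_order_on UNIV L" "P Plus \<subseteq> L" "P Minus \<subseteq> L"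
    using compatible by (auto simp: compatible_def)
  have tr: "trans L" "antisym L" "refl L" "total_on UNIV L"
    using L(1) by (auto simp: linear_order_on_def partial_order_on_def preorder_on_def)
  define h where "h a = card {b. (b, a) \<in> L}" for a
  define r :: "'a hat \<Rightarrow> nat" where
    "r x = (case x of Hat0 \<Rightarrow> 0 | Elem a \<Rightarrow> h a | Hat1 \<Rightarrow> Suc CARD('a))" for x
  have h0: "0 < h a" for a
    unfolding h_def using tr(3) by (subst card_gt_0_iff) (auto simp: refl_on_def)
  have h1: "h a < Suc CARD('a)" for a
    unfolding h_def by (simp add: less_Suc_eq_le card_mono)
  have hL: "h a < h b" if "(a, b) \<in> L" "a \<noteq> b" for a b
    unfolding h_def
  proof (rule psubset_card_mono)
    have "(b, b) \<in> L" "(b, a) \<notin> L"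
      using that tr(2,3) by (auto simp: refl_on_def dest: antisymD)
    then show "{c. (c, a) \<in> L} \<subset> {c. (c, b) \<in> L}"
      using that tr(1) by (auto dest: transD)
  qed simp
  have inj_h: "a = b" if "h a = h b" for a b
    using hL[of a b] hL[of b a] that tr(4) by (auto simp: total_on_def)
  have "inj r"
  proof (rule injI)
    fix x y assume "r x = r y"
    then show "x = y"
      using h0 h1 inj_h by (cases x; cases y) (auto simp: r_def dest: less_imp_neq, (metis less_irrefl)+)
  qed
  moreover have "r x < r y" if "hat_less (P \<sigma>) x y" for \<sigma> x y
  proof -
    have "P \<sigma> \<subseteq> L"
      using L by (cases \<sigma>) auto
    then show ?thesis
      using that h0 h1 hL unfolding r_def hat_less_def hat_le_def
      by (cases x; cases y) auto
  qed
  ultimately show ?thesis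
    by blast
qed

definition rank :: "'a hat \<Rightarrow> nat" where
  "rank = (SOME r. inj r \<and> (\<forall>\<sigma> x y. hat_less (P \<sigma>) x y \<longrightarrow> r x < r y))"

lemma inj_rank: "inj rank" and rank_less: "hat_less (P \<sigma>) x y \<Longrightarrow> rank x < rank y"
  using someI_ex[OF rank_exists] unfolding rank_def by blast+

text \<open>Relations of both signs increase the rank, so an alternating chain never returns to an
  element.\<close>

lemma alternating_strict_sorted:
  assumes "alternating P \<sigma> ps"
  shows "sorted_wrt (<) (map rank ps)"
  using assms rank_less
  by (subst sorted_wrt_iff_nth_Suc_transp) (auto simp: alternating_def)

lemma alternating_distinct: "alternating P \<sigma> ps \<Longrightarrow> distinct ps"
  using alternating_strict_sorted[of \<sigma> ps] by (auto simp: strict_sorted_iff distinct_map)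

lemma alternating_chains_eq: "alternating_chains P = partial_chains P Hat1"
proof -
  have "2 \<le> length ps" if "ps \<noteq> []" "hd ps = Hat0" "last ps = Hat1" for ps :: "'a hat list"
    using that by (cases ps rule: remdups_adj.cases) auto
  then show ?thesis
    unfolding alternating_chains_def partial_chains_def
    using alternating_distinct by (auto simp: alternating_def)
qed

lemma finite_partial_chains: "finite (partial_chains P x)"
proof (rule finite_subset)
  show "partial_chains P x \<subseteq> UNIV \<times> {ps. set ps \<subseteq> UNIV \<and> distinct ps}"
    using alternating_distinct by (auto simp: partial_chains_def)
  show "finite (UNIV \<times> {ps :: 'a hat list. set ps \<subseteq> UNIV \<and> distinct ps} :: (sign \<times> _) set)"
    by (intro finite_cartesian_product finite_subset_distinct) auto
qed

lemma finite_alternating_chains: "finite (alternating_chains P)"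
  by (simp add: alternating_chains_eq finite_partial_chains)

text \<open>These one-relation paths carry the function \<open>0\<close>: they make the sets under
  the maximum in \<open>potential\<close> nonempty and the potentials nonnegative.\<close>

lemma partial_chains_pair: "x \<noteq> Hat0 \<Longrightarrow> (\<sigma>, [Hat0, x]) \<in> partial_chains P x"
  by (auto simp: partial_chains_def alternating_def hat_less_def hat_le_def)

lemma end_sign_pair: "end_sign (\<sigma>, [Hat0, x]) = \<sigma>"
  by (simp add: end_sign_def)

lemma chain_function_pair: "chain_function (\<sigma>, [Hat0, x]) = 0"
  by (simp add: chain_function_def)

end

section \<open>Alternating sums and order polytopes\<close>

text \<open>For \<open>f\<close> in an order polytope this is its order-preserving extension to the
  bounded poset. Unlike \<open>coord\<close> it is \<open>1\<close> at \<open>Hat1\<close>, so the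
  increments along a chain sum to \<open>1\<close>.\<close>

fun hat_eval :: "real ^ 'a::finite \<Rightarrow> 'a hat \<Rightarrow> real" where
  "hat_eval f Hat0 = 0"
| "hat_eval f (Elem a) = f $ a"
| "hat_eval f Hat1 = 1"

text \<open>Summation by parts: an inner value \<open>h i\<close> occurs in two neighbouring
  differences, both times with the same sign.\<close>

lemma alternating_sum_differences:
  fixes h :: "nat \<Rightarrow> real"
  shows "(\<Sum>i<Suc n. (- 1) ^ i * (h (Suc i) - h i)) =
    - 2 * (\<Sum>i = 1..<Suc n. (- 1) ^ i * h i) - h 0 + (- 1) ^ n * h (Suc n)"
  by (induction n) (simp_all add: algebra_simps)

text \<open>The indices satisfying \<open>b\<close> form a final block. Its terms cancel in pairs
  from below and leave at most the topmost.\<close>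

lemma mono_indicator_alternating_sum:
  fixes b :: "nat \<Rightarrow> bool"
  assumes "\<And>i j. i \<le> j \<Longrightarrow> j < Suc n \<Longrightarrow> b i \<Longrightarrow> b j"
  shows "(\<Sum>i = 1..<Suc n. (- 1) ^ i * of_bool (b i)) \<in> {0, (- 1) ^ n :: real}"
  using assms
proof (induction n)
  case (Suc n)
  have "(\<Sum>i = 1..<Suc n. (- 1) ^ i * of_bool (b i)) \<in> {0, (- 1) ^ n :: real}"
    using Suc.prems by (intro Suc.IH) auto
  moreover have "(\<Sum>i = 1..<Suc n. (- 1) ^ i * of_bool (b i)) = (0 :: real)" if "\<not> b (Suc n)"
    using that Suc.prems by (intro sum.neutral) (metis atLeastLessThan_iff lessI less_imp_le
        mult_zero_right of_bool_eq(1))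
  ultimately show ?case
    by (cases "b (Suc n)") auto
qed simp

lemma order_polytopeI:
  assumes "\<And>a. 0 \<le> f $ a" "\<And>a. f $ a \<le> 1" "\<And>a b. (a, b) \<in> r \<Longrightarrow> f $ a \<le> f $ b"
  shows "f \<in> order_polytope r"
  using assms by (auto simp: order_polytope_def)

text \<open>The definition constrains coordinates only through pairs of \<open>r\<close>;
  reflexivity brings in every coordinate.\<close>

lemma order_polytopeD:
  assumes "f \<in> order_polytope r" "refl r"
  shows "0 \<le> f $ a" "f $ a \<le> 1" "(a, b) \<in> r \<Longrightarrow> f $ a \<le> f $ b"
  using assms by (auto simp: order_polytope_def refl_on_def)

lemma zero_in_order_polytope: "0 \<in> order_polytope r"
  by (auto intro: order_polytopeI)

lemma hat_eval_mono:
  assumes "f \<in> order_polytope r" "refl r" "hat_less r x y"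
  shows "hat_eval f x \<le> hat_eval f y"
  using assms order_polytopeD[OF assms(1,2)]
  by (cases x; cases y) (auto simp: hat_less_def hat_le_def)

lemma polytope_order_polytope:
  assumes "refl r"
  shows "polytope (order_polytope r)"
proof -
  have eq: "order_polytope r =
      (\<Inter>(a, b)\<in>r. {f. axis a (- 1) \<bullet> f \<le> 0} \<inter>
         {f. (axis a 1 - axis b 1) \<bullet> f \<le> 0} \<inter> {f. axis b 1 \<bullet> f \<le> 1})"
    by (auto simp: order_polytope_def inner_axis' inner_diff_left)
  have "polyhedron (order_polytope r)"
    unfolding eq by (intro polyhedron_Inter) (auto intro!: polyhedron_Int polyhedron_halfspace_le)
  moreover have "bounded (order_polytope r)"
  proof (rule bounded_subset)
    show "order_polytope r \<subseteq> cbox 0 1"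
      using order_polytopeD[OF _ assms] by (auto simp: mem_box_cart)
  qed simp
  ultimately show ?thesis
    by (simp add: polytope_eq_bounded_polyhedron)
qed

section \<open>Chain functions on order polytopes\<close>

context compatible_double_poset
begin

lemma refl_P: "refl (P \<sigma>)"
  using partial_order by (auto simp: partial_order_on_def preorder_on_def)

lemma convex_order_polytope: "convex (order_polytope (P \<sigma>))"
  using polytope_order_polytope[OF refl_P] polytope_imp_convex by blast

lemma chain_nth:
  assumes "(\<sigma>, ps) \<in> alternating_chains P"
  shows "ps ! 0 = Hat0" "ps ! (length ps - 1) = Hat1" "2 \<le> length ps" "alternating P \<sigma> ps"
    and "distinct ps"
proof -
  have *: "2 \<le> length ps" "hd ps = Hat0" "last ps = Hat1" "alternating P \<sigma> ps"
    using assms by (auto simp: alternating_chains_eq partial_chains_def)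
  moreover from this have "ps \<noteq> []"
    by auto
  ultimately show "ps ! 0 = Hat0" "ps ! (length ps - 1) = Hat1" "2 \<le> length ps"
      "alternating P \<sigma> ps"
    using hd_conv_nth last_conv_nth by metis+
  then show "distinct ps"
    using alternating_distinct by auto
qed

lemma chain_inner:
  assumes C: "(\<sigma>, ps) \<in> alternating_chains P" and i: "1 \<le> i" "i < length ps - 1"
  shows "\<exists>a. ps ! i = Elem a"
proof (cases "ps ! i")
  case Hat0
  then have "ps ! i = ps ! 0"
    using chain_nth[OF C] by simp
  then show ?thesis
    using i nth_eq_iff_index_eq[OF chain_nth(5)[OF C], of i 0] by force
next
  case Hat1
  then have "ps ! i = ps ! (length ps - 1)"
    using chain_nth[OF C] by simp
  then show ?thesis
    using i nth_eq_iff_index_eq[OF chain_nth(5)[OF C], of i "length ps - 1"] by force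
qed auto

lemma chain_function_inner:
  assumes C: "(\<sigma>, ps) \<in> alternating_chains P"
  shows "chain_function (\<sigma>, ps) \<bullet> f =
    sign_val \<sigma> * (\<Sum>i = 1..<length ps - 1. (- 1) ^ i * hat_eval f (ps ! i))"
proof -
  have "coord (ps ! i) \<bullet> f = hat_eval f (ps ! i)" if "i \<in> {1..<length ps - 1}" for i
    using that chain_inner[OF C, of i] by (auto simp: inner_axis')
  then show ?thesis
    by (simp add: chain_function_def inner_sum_left)
qed

text \<open>
  The slack is the sum of the increments of \<open>f\<close> over those relations of the chain that carry the
  sign \<open>\<rho>\<close>.
\<close>

lemma chain_function_bound:
  assumes C: "C \<in> alternating_chains P" and f: "f \<in> order_polytope (P \<rho>)"
  shows "sign_val \<rho> * (chain_function C \<bullet> f) \<le> (1 + sign_val \<rho> * sign_val (end_sign C)) / 2"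
proof -
  obtain \<sigma> ps where Ceq: "C = (\<sigma>, ps)"
    by (cases C)
  note C' = C[unfolded Ceq]
  obtain n where n: "length ps = Suc (Suc n)"
    using chain_nth(3)[OF C'] by (metis Suc_le_D add_2_eq_Suc le_Suc_ex)
  define h where "h i = hat_eval f (ps ! i)" for i
  define s where "s i = sign_val \<sigma> * (- 1) ^ i" for i :: nat
  have h: "h 0 = 0" "h (Suc n) = 1"
    using chain_nth(1,2)[OF C'] n by (auto simp: h_def)
  \<comment> \<open>Since \<open>s i\<close> is the sign of the relation between entries
    \<open>i\<close> and \<open>Suc i\<close>, the fraction is \<open>1\<close> if that sign is
    \<rho> and \<open>0\<close> otherwise.\<close>
  have "0 \<le> (1 + sign_val \<rho> * s i) / 2 * (h (Suc i) - h i)" if "i < Suc n" for i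
  proof -
    define \<tau> where "\<tau> = (if even i then \<sigma> else opp \<sigma>)"
    have \<tau>: "s i = sign_val \<tau>"
      by (simp add: s_def \<tau>_def)
    have less: "hat_less (P \<tau>) (ps ! i) (ps ! Suc i)"
      using chain_nth(4)[OF C'] that n by (auto simp: alternating_def \<tau>_def)
    show ?thesis
    proof (cases "\<tau> = \<rho>")
      case True
      then have "h i \<le> h (Suc i)"
        using hat_eval_mono[OF f refl_P] less by (simp add: h_def)
      then show ?thesis
        using True by (simp add: \<tau>)
    next
      case False
      then have "sign_val \<rho> * s i = - 1"
        unfolding \<tau> by (cases \<tau>; cases \<rho>) auto
      then show ?thesis
        by simp
    qed
  qed
  then have "0 \<le> (\<Sum>i<Suc n. (1 + sign_val \<rho> * s i) / 2 * (h (Suc i) - h i))"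
    by (intro sum_nonneg) auto
  also have "\<dots> = (\<Sum>i<Suc n. (h (Suc i) - h i)) / 2 +
      sign_val \<rho> * sign_val \<sigma> * (\<Sum>i<Suc n. (- 1) ^ i * (h (Suc i) - h i)) / 2"
    unfolding sum_distrib_left sum_divide_distrib sum.distrib[symmetric]
    by (intro sum.cong) (auto simp: s_def field_simps)
  also have "(\<Sum>i<Suc n. (h (Suc i) - h i)) = 1"
    using h by (subst sum_lessThan_telescope) simp
  also have "(\<Sum>i<Suc n. (- 1) ^ i * (h (Suc i) - h i)) =
      - 2 * (\<Sum>i = 1..<Suc n. (- 1) ^ i * h i) + (- 1) ^ n"
    using h by (subst alternating_sum_differences) simp
  also have "1 / 2 + sign_val \<rho> * sign_val \<sigma> *
        (- 2 * (\<Sum>i = 1..<Suc n. (- 1) ^ i * h i) + (- 1) ^ n) / 2 =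
      (1 + sign_val \<rho> * sign_val (end_sign C)) / 2 - sign_val \<rho> * (chain_function C \<bullet> f)"
    unfolding Ceq chain_function_inner[OF C'] sign_val_end_sign n
    by (simp add: h_def field_simps)
  finally show ?thesis
    by simp
qed

section \<open>Longest-path potentials\<close>

text \<open>The last sign is recorded because it decides how a path may continue. No path ends at
  \<open>Hat0\<close>, where this is the maximum of the empty set; hence the assumption
  \<open>x \<noteq> Hat0\<close> in several lemmas below.\<close>

definition potential :: "real ^ 'a \<Rightarrow> sign \<Rightarrow> 'a hat \<Rightarrow> real" where
  "potential y s x = Max ((\<lambda>C. chain_function C \<bullet> y) ` {C \<in> partial_chains P x. end_sign C = s})"

lemma potential_ge:
  "C \<in> partial_chains P x \<Longrightarrow> chain_function C \<bullet> y \<le> potential y (end_sign C) x"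
  unfolding potential_def using finite_partial_chains[of x] by (intro Max_ge) auto

lemma potential_attained:
  assumes "x \<noteq> Hat0"
  obtains C where "C \<in> partial_chains P x" "end_sign C = s" "potential y s x = chain_function C \<bullet> y"
proof -
  have "potential y s x \<in> (\<lambda>C. chain_function C \<bullet> y) ` {C \<in> partial_chains P x. end_sign C = s}"
    unfolding potential_def
    using finite_partial_chains[of x] partial_chains_pair[OF assms] end_sign_pair
    by (intro Max_in) force+
  then show ?thesis
    using that by auto
qed

lemma potential_nonneg: "x \<noteq> Hat0 \<Longrightarrow> 0 \<le> potential y s x"
  using potential_ge[OF partial_chains_pair, of x s y] by (simp add: end_sign_pair chain_function_pair)

text \<open>An optimal path to \<open>x\<close> with last sign \<open>s\<close> can be redirected to
  \<open>x'\<close> at the same value.\<close>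

lemma potential_mono:
  assumes "x \<noteq> Hat0" "hat_less (P s) x x'"
  shows "potential y s x \<le> potential y s x'"
proof -
  obtain \<sigma> ps where C: "(\<sigma>, ps) \<in> partial_chains P x" "end_sign (\<sigma>, ps) = s"
      "potential y s x = chain_function (\<sigma>, ps) \<bullet> y"
    using potential_attained[OF assms(1)] by (metis surj_pair)
  have "hat_less (P (end_sign (\<sigma>, ps))) x x'"
    using assms C by simp
  from partial_chains_replace_last[OF C(1) double_poset this] show ?thesis
    using potential_ge C by metis
qed

text \<open>An optimal path to \<open>x\<close> with the opposite last sign is continued to
  \<open>x'\<close>, with \<open>x\<close> as a new inner element.\<close>

lemma potential_step:
  assumes "x \<noteq> Hat0" "hat_less (P s) x x'"
  shows "potential y (opp s) x + sign_val s * (coord x \<bullet> y) \<le> potential y s x'"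
proof -
  obtain \<sigma> ps where C: "(\<sigma>, ps) \<in> partial_chains P x" "end_sign (\<sigma>, ps) = opp s"
      "potential y (opp s) x = chain_function (\<sigma>, ps) \<bullet> y"
    using potential_attained[OF assms(1)] by (metis surj_pair)
  have "hat_less (P (opp (end_sign (\<sigma>, ps)))) x x'"
    using assms C by simp
  note ext = partial_chains_snoc[OF C(1) this]
  have "chain_function (\<sigma>, ps @ [x']) \<bullet> y = potential y (opp s) x + sign_val s * (coord x \<bullet> y)"
    using ext(3) C by (simp add: inner_add_left)
  then show ?thesis
    using potential_ge[OF ext(1), of y] ext(2) C(2) by simp
qed

section \<open>Inequality description of the double order polytope\<close>

text \<open>At height \<open>t\<close> the two convex weights are \<open>(1 + t) / 2\<close> and
  \<open>(1 - t) / 2\<close>; the factors \<open>2\<close> in the definition cancel the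
  denominators.\<close>

lemma mem_double_order_polytope_iff:
  "(y, t) \<in> double_order_polytope P \<longleftrightarrow> - 1 \<le> t \<and> t \<le> 1 \<and>
     (\<exists>f \<in> order_polytope (P Plus). \<exists>g \<in> order_polytope (P Minus).
        y = (1 + t) *\<^sub>R f - (1 - t) *\<^sub>R g)" (is "?L \<longleftrightarrow> ?R")
proof -
  define S where "S = ((\<lambda>f. 2 *\<^sub>R f) ` order_polytope (P Plus)) \<times> {1 :: real}"
  define T where "T = ((\<lambda>f. - 2 *\<^sub>R f) ` order_polytope (P Minus)) \<times> {- 1 :: real}"
  have ne: "S \<noteq> {}" "T \<noteq> {}"
    using zero_in_order_polytope by (auto simp: S_def T_def)
  have conv: "convex S" "convex T"
    unfolding S_def T_def by (intro convex_Times convex_scaling convex_order_polytope; simp)+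
  have eq: "double_order_polytope P =
      {u *\<^sub>R s + v *\<^sub>R t |u v s t. 0 \<le> u \<and> 0 \<le> v \<and> u + v = 1 \<and> s \<in> S \<and> t \<in> T}"
    unfolding double_order_polytope_def S_def[symmetric] T_def[symmetric]
    by (rule convex_hull_union_two[OF conv(1) ne(1) conv(2) ne(2)])
  show ?thesis
  proof
    assume ?L
    then obtain u v s s' where *: "(y, t) = u *\<^sub>R s + v *\<^sub>R s'" "0 \<le> u" "0 \<le> v" "u + v = 1"
        "s \<in> S" "s' \<in> T"
      unfolding eq by blast
    then obtain f g where fg: "f \<in> order_polytope (P Plus)" "g \<in> order_polytope (P Minus)"
        "s = (2 *\<^sub>R f, 1)" "s' = (- 2 *\<^sub>R g, - 1)"
      by (auto simp: S_def T_def)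
    have "t = u - v" "y = (2 * u) *\<^sub>R f - (2 * v) *\<^sub>R g"
      using * fg by (auto simp: mult.commute)
    moreover have "2 * u = 1 + (u - v)" "2 * v = 1 - (u - v)"
      using * by auto
    ultimately have "- 1 \<le> t" "t \<le> 1" "y = (1 + t) *\<^sub>R f - (1 - t) *\<^sub>R g"
      using * by simp_all
    then show ?R
      using fg by blast
  next
    assume ?R
    then obtain f g where fg: "- 1 \<le> t" "t \<le> 1" "f \<in> order_polytope (P Plus)"
      "g \<in> order_polytope (P Minus)" "y = (1 + t) *\<^sub>R f - (1 - t) *\<^sub>R g"
      by blast
    define u where "u = (1 + t) / 2"
    define v where "v = (1 - t) / 2"
    have uv: "1 + t = 2 * u" "1 - t = 2 * v" "t = u - v"
      by (simp_all add: u_def v_def field_simps)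
    have "(y, t) = u *\<^sub>R (2 *\<^sub>R f, 1) + v *\<^sub>R (- 2 *\<^sub>R g, - 1)"
      unfolding fg(5) uv(1,2) by (simp add: uv(3) mult.commute)
    moreover have "0 \<le> u" "0 \<le> v" "u + v = 1"
      using fg(1,2) by (auto simp: u_def v_def field_simps)
    moreover have "(2 *\<^sub>R f, 1) \<in> S" "(- 2 *\<^sub>R g, - 1) \<in> T"
      using fg by (auto simp: S_def T_def)
    ultimately show ?L
      unfolding eq by blast
  qed
qed

lemma end_sign_cases: "sign_val (end_sign C) = 1 \<or> sign_val (end_sign C) = - 1"
  by (cases "end_sign C") auto

lemma trivial_chain: "(\<sigma>, [Hat0, Hat1]) \<in> alternating_chains P"
  by (simp add: alternating_chains_eq partial_chains_pair)

lemma facet_normal_trivial: "facet_normal (\<sigma>, [Hat0, Hat1]) = (0, - sign_val \<sigma>)"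
  by (simp add: facet_normal_def end_sign_pair chain_function_pair)

lemma double_order_polytope_inequality:
  assumes C: "C \<in> alternating_chains P" and x: "x \<in> double_order_polytope P"
  shows "facet_normal C \<bullet> x \<le> 1"
proof -
  obtain y t where xeq: "x = (y, t)" by (cases x)
  obtain f g where fg: "- 1 \<le> t" "t \<le> 1" "f \<in> order_polytope (P Plus)"
      "g \<in> order_polytope (P Minus)" "y = (1 + t) *\<^sub>R f - (1 - t) *\<^sub>R g"
    using x unfolding xeq mem_double_order_polytope_iff by auto
  define s where "s = sign_val (end_sign C)"
  have "chain_function C \<bullet> f \<le> (1 + s) / 2" "- (chain_function C \<bullet> g) \<le> (1 - s) / 2"
    using chain_function_bound[OF C fg(3)] chain_function_bound[OF C fg(4)] by (simp_all add: s_def)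
  then have "(1 + t) * (chain_function C \<bullet> f) + (1 - t) * - (chain_function C \<bullet> g) \<le>
      (1 + t) * ((1 + s) / 2) + (1 - t) * ((1 - s) / 2)"
    using fg(1,2) by (intro add_mono mult_left_mono) auto
  \<comment> \<open>The surplus \<open>s * t\<close> is absorbed by the last coordinate of
    \<open>facet_normal C\<close>.\<close>
  also have "\<dots> = 1 + s * t"
    by (simp add: field_simps)
  finally show ?thesis
    by (simp add: xeq facet_normal_def fg(5) inner_diff_right s_def)
qed

lemma double_order_polytope_sufficient:
  assumes "\<And>C. C \<in> alternating_chains P \<Longrightarrow> facet_normal C \<bullet> x \<le> 1"
  shows "x \<in> double_order_polytope P"
proof -
  obtain y t where xeq: "x = (y, t)" by (cases x)
  have t: "- 1 \<le> t" "t \<le> 1"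
    using assms[OF trivial_chain[of Plus]] assms[OF trivial_chain[of Minus]]
    by (auto simp: facet_normal_trivial xeq)
  have top: "potential y s Hat1 \<le> 1 + sign_val s * t" for s
  proof -
    obtain C where C: "C \<in> partial_chains P Hat1" "end_sign C = s"
        "potential y s Hat1 = chain_function C \<bullet> y"
      using potential_attained[of Hat1 s y] by auto
    then show ?thesis
      using assms[of C] by (simp add: alternating_chains_eq facet_normal_def xeq)
  qed
  \<comment> \<open>\<open>h\<close> will be \<open>(1 + t) f\<close> and \<open>h - y\<close> will
    be \<open>(1 - t) g\<close>. Going up in \<open>P Plus\<close>, both terms of the maximum are
    bounded by \<open>potential y Plus\<close> at the upper element, one by
    \<open>potential_mono\<close>, the other by \<open>potential_step\<close>. Subtracting
    \<open>y\<close> exchanges the roles of the signs.\<close>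
  define h where "h a = max (potential y Plus (Elem a)) (potential y Minus (Elem a) + y $ a)" for a
  have less1: "hat_less (P s) (Elem a) Hat1" for s a
    by (simp add: hat_less_def hat_le_def)
  have h0: "0 \<le> h a" "0 \<le> h a - y $ a" for a
    using potential_nonneg[of "Elem a" y Plus] potential_nonneg[of "Elem a" y Minus]
    by (auto simp: h_def)
  have h1: "h a \<le> 1 + t" "h a - y $ a \<le> 1 - t" for a
    using top[of Plus] top[of Minus] potential_mono[OF _ less1, of a y Plus]
      potential_mono[OF _ less1, of a y Minus] potential_step[OF _ less1, of a y Plus]
      potential_step[OF _ less1, of a y Minus]
    by (auto simp: h_def inner_coord_Elem[simplified])
  have hless: "hat_less (P s) (Elem a) (Elem b)" if "(a, b) \<in> P s" "a \<noteq> b" for s a b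
    using that by (simp add: hat_less_def hat_le_def)
  have hp: "h a \<le> h b" if "(a, b) \<in> P Plus" for a b
    using potential_mono[OF _ hless, of a b Plus y] potential_step[OF _ hless, of a b Plus y] that
    by (cases "a = b") (auto simp: h_def inner_coord_Elem[simplified])
  have hm: "h a - y $ a \<le> h b - y $ b" if "(a, b) \<in> P Minus" for a b
    using potential_mono[OF _ hless, of a b Minus y] potential_step[OF _ hless, of a b Minus y] that
    by (cases "a = b") (auto simp: h_def inner_coord_Elem[simplified])
  \<comment> \<open>If \<open>1 + t = 0\<close>, the quotient is \<open>0\<close> by convention, and
    so is \<open>h\<close>, squeezed between \<open>0\<close> and \<open>1 + t\<close>; likewise for
    \<open>1 - t\<close> and \<open>h - y\<close>.\<close>
  define f where "f = (\<chi> a. h a / (1 + t))"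
  define g where "g = (\<chi> a. (h a - y $ a) / (1 - t))"
  have "f \<in> order_polytope (P Plus)" "g \<in> order_polytope (P Minus)"
    using h0 h1 hp hm t by (auto intro!: order_polytopeI divide_right_mono divide_nonneg_nonneg
        simp: f_def g_def divide_le_eq_1)
  moreover have "y = (1 + t) *\<^sub>R f - (1 - t) *\<^sub>R g"
  proof (rule vec_eq_iff[THEN iffD2], rule allI)
    fix a
    have "(1 + t) * (h a / (1 + t)) = h a"
      using h0(1)[of a] h1(1)[of a] by (cases "1 + t = 0") auto
    moreover have "(1 - t) * ((h a - y $ a) / (1 - t)) = h a - y $ a"
      using h0(2)[of a] h1(2)[of a] by (cases "1 - t = 0") auto
    ultimately show "y $ a = ((1 + t) *\<^sub>R f - (1 - t) *\<^sub>R g) $ a"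
      by (simp add: f_def g_def)
  qed
  ultimately show ?thesis
    using t unfolding xeq mem_double_order_polytope_iff by blast
qed

lemma double_order_polytope_eq:
  "double_order_polytope P = {x. \<forall>C \<in> alternating_chains P. facet_normal C \<bullet> x \<le> 1}"
  using double_order_polytope_inequality double_order_polytope_sufficient by blast

end

section \<open>Normal cones and maximal faces\<close>

lemma parallel_if_orthogonal_subset:
  fixes a b :: "'v::real_inner"
  assumes "\<And>d. a \<bullet> d = 0 \<Longrightarrow> b \<bullet> d = 0"
  shows "\<exists>k. b = k *\<^sub>R a"
proof -
  \<comment> \<open>\<open>d\<close> is the component of \<open>b\<close> orthogonal to
    \<open>a\<close>; for \<open>a = 0\<close> the quotient is \<open>0\<close> and
    \<open>d = b\<close>.\<close>
  define d where "d = b - (b \<bullet> a / (a \<bullet> a)) *\<^sub>R a"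
  have "a \<bullet> d = 0"
    by (auto simp: d_def inner_diff_right inner_commute)
  moreover from this have "b \<bullet> d = 0"
    by (rule assms)
  ultimately have "d \<bullet> d = 0"
    by (simp add: d_def inner_diff_left)
  then show ?thesis
    by (auto simp: d_def)
qed

lemma normal_coneD:
  assumes "l \<in> normal_cone r F" "f \<in> F"
  shows "f \<in> order_polytope r" "g \<in> order_polytope r \<Longrightarrow> l \<bullet> g \<le> l \<bullet> f"
  using assms by (auto simp: normal_cone_def max_face_def)

lemma convex_normal_cone: "convex (normal_cone r F)"
  by (rule convexI)
    (auto simp: normal_cone_def max_face_def subset_iff inner_add_left intro!: add_mono mult_left_mono)

text \<open>The indicators of the principal up-set of an element and of this set without its minimum
  both lie in the polytope, and they differ by a basis vector.\<close>

lemma order_polytope_inner_const_imp_zero: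
  assumes r: "partial_order_on UNIV r"
    and const: "\<And>f g. f \<in> order_polytope r \<Longrightarrow> g \<in> order_polytope r \<Longrightarrow> l \<bullet> f \<le> l \<bullet> g"
  shows "l = 0"
proof (rule vec_eq_iff[THEN iffD2], rule allI)
  fix a
  define f :: "real ^ 'a" where "f = (\<chi> b. of_bool ((a, b) \<in> r))"
  define g :: "real ^ 'a" where "g = (\<chi> b. of_bool ((a, b) \<in> r \<and> a \<noteq> b))"
  have tr: "trans r" "antisym r" "refl r"
    using r by (auto simp: partial_order_on_def preorder_on_def)
  have "f \<in> order_polytope r"
    using tr(1) by (auto intro!: order_polytopeI simp: f_def dest: transD)
  moreover have "g \<in> order_polytope r"
    using tr(1,2) by (auto intro!: order_polytopeI simp: g_def dest: transD antisymD)
  ultimately have "l \<bullet> f = l \<bullet> g"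
    using const by (metis order_antisym)
  moreover have "f = g + axis a 1"
    using tr(3) by (auto simp: vec_eq_iff f_def g_def axis_def refl_on_def)
  ultimately show "l $ a = 0 $ a"
    by (simp add: inner_add_right inner_axis)
qed

lemma max_face_nonempty:
  assumes "refl r"
  shows "max_face r l \<noteq> {}"
proof -
  have "compact (order_polytope r)"
    using polytope_order_polytope[OF assms] polytope_imp_compact by blast
  then have "\<exists>f\<in>order_polytope r. \<forall>g\<in>order_polytope r. l \<bullet> g \<le> l \<bullet> f"
    using zero_in_order_polytope by (intro continuous_attains_sup continuous_intros) auto
  then show ?thesis
    by (auto simp: max_face_def)
qed

lemma max_face_face_of:
  assumes "refl r"
  shows "max_face r l face_of order_polytope r"
proof -
  obtain f where f: "f \<in> max_face r l"
    using max_face_nonempty[OF assms] by blast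
  then have "max_face r l = order_polytope r \<inter> {x. l \<bullet> x = l \<bullet> f}"
    by (auto simp: max_face_def intro: order_antisym)
  then show ?thesis
    using f polytope_imp_convex[OF polytope_order_polytope[OF assms]]
      face_of_Int_supporting_hyperplane_le[of "order_polytope r" l "l \<bullet> f"]
    by (auto simp: max_face_def)
qed

text \<open>Two conditions put a vector in the cone: it is constant on the face, a linear condition
  that passes to the affine hull; and it is smaller at the generators off the face, which is strict
  at \<open>l\<close> and so persists nearby.\<close>

lemma rel_interior_normal_cone_max_face:
  assumes "refl r"
  shows "l \<in> rel_interior (normal_cone r (max_face r l))"
proof -
  let ?F = "max_face r l" and ?N = "normal_cone r (max_face r l)"
  obtain V where V: "finite V" "order_polytope r = convex hull V"
    using polytope_order_polytope[OF assms] by (auto simp: polytope_def)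
  obtain f0 where f0: "f0 \<in> ?F"
    using max_face_nonempty[OF assms] by blast
  define U where "U = (\<Inter>v\<in>V - ?F. {k. (v - f0) \<bullet> k < 0})"
  have "open U"
    unfolding U_def using V(1) by (intro open_INT ballI open_halfspace_lt) auto
  moreover have "l \<in> U"
  proof -
    have "(v - f0) \<bullet> l < 0" if "v \<in> V - ?F" for v
    proof (rule ccontr)
      assume "\<not> (v - f0) \<bullet> l < 0"
      then have "l \<bullet> f0 \<le> l \<bullet> v"
        by (simp add: inner_diff_left inner_diff_right inner_commute)
      moreover have "v \<in> order_polytope r"
        using that V(2) by (auto intro: hull_inc)
      ultimately have "v \<in> ?F"
        using f0 unfolding max_face_def by (auto intro: order_trans)
      then show False
        using that by blast
    qed
    then show ?thesis
      by (auto simp: U_def)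
  qed
  moreover have "l \<in> ?N"
    by (simp add: normal_cone_def)
  moreover have "U \<inter> affine hull ?N \<subseteq> ?N"
  proof
    fix k assume k: "k \<in> U \<inter> affine hull ?N"
    have const: "k \<bullet> f = k \<bullet> f0" if "f \<in> ?F" for f
    proof -
      have "(f - f0) \<bullet> m = 0" if "m \<in> ?N" for m
        using normal_coneD[OF that \<open>f \<in> ?F\<close>] normal_coneD[OF that f0]
        by (auto simp: inner_diff_left inner_diff_right inner_commute intro: order_antisym)
      then have "affine hull ?N \<subseteq> {m. (f - f0) \<bullet> m = 0}"
        by (intro hull_minimal affine_hyperplane) auto
      then show ?thesis
        using k by (auto simp: inner_diff_left inner_diff_right inner_commute)
    qed
    have "k \<bullet> v \<le> k \<bullet> f0" if "v \<in> V" for v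
      using that k const[of v] by (cases "v \<in> ?F")
        (force simp: U_def inner_diff_left inner_diff_right inner_commute)+
    then have "convex hull V \<subseteq> {g. k \<bullet> g \<le> k \<bullet> f0}"
      by (intro hull_minimal convex_halfspace_le) auto
    then show "k \<in> ?N"
      using const V(2) by (auto simp: normal_cone_def max_face_def)
  qed
  ultimately show ?thesis
    unfolding mem_rel_interior by blast
qed

lemma mem_uminus_image [simp]: "x \<in> uminus ` S \<longleftrightarrow> - x \<in> (S :: 'v::group_add set)"
  by (metis image_iff minus_minus)

lemma rel_interior_uminus_image:
  "rel_interior (uminus ` S) = uminus ` rel_interior (S :: 'v::euclidean_space set)"
  by (rule rel_interior_injective_linear_image) (auto intro: bounded_linear_minus bounded_linear_ident)

section \<open>Irredundancy of the chain inequalities\<close>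

context compatible_double_poset
begin

text \<open>These are indicators of up-sets of a common linear extension; as \<open>rank\<close> is
  injective, consecutive ones differ by at most one basis vector.\<close>

definition tail :: "nat \<Rightarrow> real ^ 'a" where
  "tail j = (\<chi> a. of_bool (j \<le> rank (Elem a)))"

text \<open>
  The signs along a chain alternate, so summing its coefficients from the top down to any rank
  gives either \<open>0\<close> or the sign of the topmost element.
\<close>

lemma chain_function_tail:
  assumes C: "C \<in> alternating_chains P"
  shows "chain_function C \<bullet> tail j \<in> {0, sign_val (end_sign C)}"
proof -
  obtain \<sigma> ps where Ceq: "C = (\<sigma>, ps)"
    by (cases C)
  note C' = C[unfolded Ceq]
  obtain n where n: "length ps = Suc (Suc n)"
    using chain_nth(3)[OF C'] by (metis Suc_le_D add_2_eq_Suc le_Suc_ex)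
  define b where "b i \<longleftrightarrow> j \<le> rank (ps ! i)" for i
  have eval: "hat_eval (tail j) (ps ! i) = of_bool (b i)" if i: "i \<in> {1..<Suc n}" for i
  proof -
    obtain a where "ps ! i = Elem a"
      using i n chain_inner[OF C', of i] by auto
    then show ?thesis
      by (simp add: b_def tail_def)
  qed
  have "b k" if "i \<le> k" "k < Suc n" "b i" for i k
  proof (cases "i = k")
    case False
    then have "rank (ps ! i) < rank (ps ! k)"
      using that n alternating_strict_sorted[OF chain_nth(4)[OF C']]
        sorted_wrt_nth_less[of "(<)" "map rank ps" i k] by auto
    then show ?thesis
      using that by (simp add: b_def)
  qed (use that in auto)
  then have "(\<Sum>i = 1..<Suc n. (- 1) ^ i * of_bool (b i)) \<in> {0, (- 1) ^ n :: real}"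
    by (rule mono_indicator_alternating_sum)
  moreover have "(\<Sum>i = 1..<Suc n. (- 1) ^ i * hat_eval (tail j) (ps ! i)) =
      (\<Sum>i = 1..<Suc n. (- 1) ^ i * of_bool (b i))"
    using eval by (intro sum.cong) simp_all
  ultimately have "(\<Sum>i = 1..<Suc n. (- 1) ^ i * hat_eval (tail j) (ps ! i)) \<in> {0, (- 1) ^ n}"
    by (simp only:)
  then show ?thesis
    by (auto simp: Ceq chain_function_inner[OF C'] sign_val_end_sign n simp del: sum.op_ivl_Suc)
qed

text \<open>An element occurs at most once in a chain, so nothing cancels and the support of the
  function reveals the inner elements.\<close>

lemma chain_function_nonzero_iff:
  assumes C: "(\<sigma>, ps) \<in> alternating_chains P"
  shows "chain_function (\<sigma>, ps) $ a \<noteq> 0 \<longleftrightarrow> Elem a \<in> set ps"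
proof -
  have eval: "hat_eval (axis a 1) (ps ! i) = of_bool (ps ! i = Elem a)"
    if i: "i \<in> {1..<length ps - 1}" for i
  proof -
    obtain b where "ps ! i = Elem b"
      using i chain_inner[OF C, of i] by auto
    then show ?thesis
      by (simp add: axis_def)
  qed
  have eq: "chain_function (\<sigma>, ps) $ a =
      sign_val \<sigma> * (\<Sum>i = 1..<length ps - 1. (- 1) ^ i * of_bool (ps ! i = Elem a))"
    using chain_function_inner[OF C, of "axis a 1"] sum.cong[OF refl, of "{1..<length ps - 1}"
        "\<lambda>i. (- 1) ^ i * hat_eval (axis a 1) (ps ! i)"] eval
    by (simp add: inner_axis)
  show ?thesis
  proof (cases "Elem a \<in> set ps")
    case True
    then obtain m where m: "m < length ps" "ps ! m = Elem a"
      by (auto simp: in_set_conv_nth)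
    then have "m \<noteq> 0" "m \<noteq> length ps - 1"
      using chain_nth(1,2)[OF C] by (metis hat.distinct(1), metis hat.distinct(5))
    then have mem: "m \<in> {1..<length ps - 1}"
      using m by auto
    have "(\<Sum>i = 1..<length ps - 1. (- 1) ^ i * of_bool (ps ! i = Elem a)) =
        (\<Sum>i = 1..<length ps - 1. if i = m then (- 1) ^ i else (0 :: real))"
      using m nth_eq_iff_index_eq[OF chain_nth(5)[OF C], of _ m] by (intro sum.cong) auto
    also have "\<dots> = (- 1) ^ m"
      using mem by simp
    finally show ?thesis
      unfolding eq using True by (cases \<sigma>) auto
  next
    case False
    then have "(\<Sum>i = 1..<length ps - 1. (- 1) ^ i * of_bool (ps ! i = Elem a)) = (0 :: real)"
      by (intro sum.neutral) (auto simp: in_set_conv_nth)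
    then show ?thesis
      unfolding eq using False by simp
  qed
qed

text \<open>The support determines the set of entries, the rank their order, and the last
  coordinate, once the length is known, the first sign.\<close>

lemma inj_on_facet_normal: "inj_on facet_normal (alternating_chains P)"
proof (rule inj_onI, clarify)
  fix \<sigma> ps \<sigma>' ps'
  assume C: "(\<sigma>, ps) \<in> alternating_chains P" and C': "(\<sigma>', ps') \<in> alternating_chains P"
    and eq: "facet_normal (\<sigma>, ps) = facet_normal (\<sigma>', ps')"
  have "Elem a \<in> set ps \<longleftrightarrow> Elem a \<in> set ps'" for a
    using eq chain_function_nonzero_iff[OF C] chain_function_nonzero_iff[OF C']
    by (simp add: facet_normal_def)
  moreover have "Hat0 \<in> set qs" "Hat1 \<in> set qs" if "(\<tau>, qs) \<in> alternating_chains P" for \<tau> qs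
    using that by (auto simp: alternating_chains_def dest: hd_in_set last_in_set)
  ultimately have "x \<in> set ps \<longleftrightarrow> x \<in> set ps'" for x
    using C C' by (cases x) blast+
  then have "map rank ps = map rank ps'"
    using alternating_strict_sorted[OF chain_nth(4)[OF C]]
      alternating_strict_sorted[OF chain_nth(4)[OF C']]
    by (intro strict_sorted_equal) auto
  then have ps: "ps = ps'"
    using inj_rank by (simp add: inj_map_eq_map)
  moreover have "\<sigma> = \<sigma>'"
    using eq ps by (cases \<sigma>; cases \<sigma>') (auto simp: facet_normal_def end_sign_def split: if_splits)
  ultimately show "\<sigma> = \<sigma>' \<and> ps = ps'"
    by blast
qed

text \<open>
  In the coordinates given by the vectors \<open>(2 tail j, 1)\<close> all facet normals are \<open>\<plusminus>1\<close>-vectors, that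
  is, distinct vertices of a cube, and therefore no inequality is implied by the others.
\<close>

lemma tight_point_exists:
  assumes C: "C \<in> alternating_chains P"
  shows "\<exists>x. facet_normal C \<bullet> x = 1 \<and> (\<forall>C' \<in> alternating_chains P - {C}. facet_normal C' \<bullet> x < 1)"
proof -
  \<comment> \<open>Every rank lies below \<open>N\<close>, so \<open>tail N\<close> vanishes and
    \<open>w N\<close> reads off the last sign alone.\<close>
  obtain N where N: "rank x < N" for x
    using finite_nat_set_iff_bounded[of "range rank"] by auto
  define w :: "nat \<Rightarrow> (real ^ 'a) \<times> real" where "w j = (2 *\<^sub>R tail j, 1)" for j
  have pm: "facet_normal D \<bullet> w j \<in> {1, - 1}" if "D \<in> alternating_chains P" for D j
    using chain_function_tail[OF that, of j] end_sign_cases[of D]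
    by (auto simp: w_def facet_normal_def)
  \<comment> \<open>The values of \<open>C\<close> serve as weights, so pairing with
    \<open>x\<close> averages products of numbers \<open>\<plusminus>1\<close>. For \<open>C\<close>
    itself all products are \<open>1\<close>; any other chain meets a product
    \<open>-1\<close>.\<close>
  define x where "x = (1 / real (Suc N)) *\<^sub>R (\<Sum>j<Suc N. (facet_normal C \<bullet> w j) *\<^sub>R w j)"
  have x: "facet_normal D \<bullet> x =
      (\<Sum>j<Suc N. (facet_normal C \<bullet> w j) * (facet_normal D \<bullet> w j)) / real (Suc N)" for D
    unfolding x_def by (simp only: inner_scaleR_right inner_sum_right) simp
  have "(facet_normal C \<bullet> w j) * (facet_normal C \<bullet> w j) = 1" for j
    using pm[OF C, of j] by auto
  then have "facet_normal C \<bullet> x = 1"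
    unfolding x by simp
  moreover have "facet_normal D \<bullet> x < 1" if D: "D \<in> alternating_chains P - {C}" for D
  proof -
    have D': "D \<in> alternating_chains P" "D \<noteq> C"
      using D by auto
    have "\<exists>j\<in>{..<Suc N}. facet_normal C \<bullet> w j \<noteq> facet_normal D \<bullet> w j"
    proof (rule ccontr)
      assume "\<not> ?thesis"
      then have eq: "facet_normal C \<bullet> w j = facet_normal D \<bullet> w j" if "j \<le> N" for j
        using that by auto
      have "tail N = 0"
        using N by (auto simp: tail_def vec_eq_iff not_le)
      then have s: "end_sign C = end_sign D"
        using eq[of N] by (simp add: w_def facet_normal_def)
      have T: "chain_function C \<bullet> tail j = chain_function D \<bullet> tail j" if "j \<le> N" for j
        using eq[OF that] s by (simp add: w_def facet_normal_def)
      have "chain_function C $ a = chain_function D $ a" for a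
      proof -
        have "axis a 1 = tail (rank (Elem a)) - tail (Suc (rank (Elem a)))"
          using inj_eq[OF inj_rank, of "Elem a"]
          by (auto simp: vec_eq_iff tail_def axis_def not_le less_Suc_eq_le not_less_eq_eq
              intro: order_antisym)
        then have "chain_function E $ a = chain_function E \<bullet> tail (rank (Elem a)) -
            chain_function E \<bullet> tail (Suc (rank (Elem a)))" for E
          by (metis inner_axis inner_diff_right inner_real_def mult.right_neutral)
        then show ?thesis
          using T N[of "Elem a"] by (simp add: less_imp_le)
      qed
      then have "facet_normal C = facet_normal D"
        using s by (simp add: facet_normal_def vec_eq_iff)
      then show False
        using inj_onD[OF inj_on_facet_normal _ C D'(1)] D'(2) by blast
    qed
    then obtain j where j: "j < Suc N" "facet_normal C \<bullet> w j \<noteq> facet_normal D \<bullet> w j"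
      by auto
    have "(\<Sum>j<Suc N. (facet_normal C \<bullet> w j) * (facet_normal D \<bullet> w j)) < (\<Sum>j<Suc N. 1)"
    proof (rule sum_strict_mono_ex1)
      show "\<forall>i\<in>{..<Suc N}. (facet_normal C \<bullet> w i) * (facet_normal D \<bullet> w i) \<le> 1"
      proof
        show "(facet_normal C \<bullet> w i) * (facet_normal D \<bullet> w i) \<le> 1" for i
          using pm[OF C, of i] pm[OF D'(1), of i] by auto
      qed
      show "\<exists>i\<in>{..<Suc N}. (facet_normal C \<bullet> w i) * (facet_normal D \<bullet> w i) < 1"
        using j pm[OF C, of j] pm[OF D'(1), of j] by (intro bexI[of _ j]) auto
    qed simp
    then show ?thesis
      unfolding x by simp
  qed
  ultimately show ?thesis
    by blast
qed

text \<open>The other inequalities are finitely many and strict at the tight point, hence strict on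
  a ball.\<close>

lemma tight_ball_exists:
  assumes C: "C \<in> alternating_chains P"
  obtains x e where "0 < e" "facet_normal C \<bullet> x = 1"
    and "\<And>z C'. dist x z < e \<Longrightarrow> C' \<in> alternating_chains P \<Longrightarrow> C' \<noteq> C \<Longrightarrow> facet_normal C' \<bullet> z < 1"
proof -
  obtain x where x: "facet_normal C \<bullet> x = 1"
      "\<forall>C' \<in> alternating_chains P - {C}. facet_normal C' \<bullet> x < 1"
    using tight_point_exists[OF C] by blast
  define U where "U = (\<Inter>C'\<in>alternating_chains P - {C}. {z. facet_normal C' \<bullet> z < 1})"
  have "open U"
    unfolding U_def using finite_alternating_chains by (intro open_INT ballI open_halfspace_lt) auto
  moreover have "x \<in> U"
    using x by (auto simp: U_def)
  ultimately obtain e where "0 < e" "ball x e \<subseteq> U"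
    using open_contains_ball by blast
  then show ?thesis
    using that[of e x] x by (force simp: U_def)
qed

lemma violating_only_exists:
  assumes C: "C \<in> alternating_chains P"
  obtains z where "1 < facet_normal C \<bullet> z"
    and "\<And>C'. C' \<in> alternating_chains P \<Longrightarrow> C' \<noteq> C \<Longrightarrow> facet_normal C' \<bullet> z < 1"
proof -
  obtain x e where x: "0 < e" "facet_normal C \<bullet> x = 1"
    "\<And>z C'. dist x z < e \<Longrightarrow> C' \<in> alternating_chains P \<Longrightarrow> C' \<noteq> C \<Longrightarrow> facet_normal C' \<bullet> z < 1"
    using tight_ball_exists[OF C] by metis
  define a where "a = facet_normal C"
  have a: "a \<noteq> 0"
    using x(2) by (auto simp: a_def)
  \<comment> \<open>A step of half the radius along the normal breaks the inequality of
    \<open>C\<close> alone.\<close>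
  define z where "z = x + (e / (2 * norm a)) *\<^sub>R a"
  have "dist x z < e"
    using x(1) a by (simp add: z_def dist_norm)
  moreover have "1 < facet_normal C \<bullet> z"
    using x a by (simp add: z_def inner_add_right flip: a_def)
  ultimately show ?thesis
    using that x(3) by blast
qed

text \<open>Every chain inequality is strict at the origin, which is therefore an interior
  point.\<close>

lemma affine_hull_double_order_polytope: "affine hull (double_order_polytope P) = UNIV"
proof (rule affine_hull_nonempty_interior)
  define U where "U = (\<Inter>C\<in>alternating_chains P. {z. facet_normal C \<bullet> z < 1})"
  have "open U"
    unfolding U_def using finite_alternating_chains by (intro open_INT ballI open_halfspace_lt) auto
  moreover have "U \<subseteq> double_order_polytope P"
    unfolding double_order_polytope_eq U_def by force
  moreover have "0 \<in> U"
    by (simp add: U_def)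
  ultimately show "interior (double_order_polytope P) \<noteq> {}"
    using interior_maximal by blast
qed

section \<open>Facets of the double order polytope\<close>

lemma facets_double_order_polytope:
  "F facet_of double_order_polytope P \<longleftrightarrow>
     (\<exists>C \<in> alternating_chains P. F = double_order_polytope P \<inter> {x. facet_normal C \<bullet> x = 1})"
proof -
  let ?D = "double_order_polytope P"
  define H where "H C = {x. facet_normal C \<bullet> x \<le> 1}" for C :: "sign \<times> 'a hat list"
  have HC: "\<exists>z. z \<notin> H C \<and> (\<forall>C'\<in>alternating_chains P - {C}. z \<in> H C')"
    if C: "C \<in> alternating_chains P" for C
  proof -
    obtain z where "1 < facet_normal C \<bullet> z"
        "\<And>C'. C' \<in> alternating_chains P \<Longrightarrow> C' \<noteq> C \<Longrightarrow> facet_normal C' \<bullet> z < 1"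
      using violating_only_exists[OF C] by metis
    then show ?thesis
      by (intro exI[of _ z]) (auto simp: H_def not_le intro: less_imp_le)
  qed
  have inj: "inj_on H (alternating_chains P)"
    by (rule inj_onI) (metis DiffI HC singletonD)
  \<comment> \<open>\<open>facet_of_polyhedron_explicit\<close> works with a set of halfspaces;
    injectivity of \<open>H\<close> lets the normal be recovered from the halfspace.\<close>
  define a where "a h = facet_normal (the_inv_into (alternating_chains P) H h)" for h
  have a: "a (H C) = facet_normal C" if "C \<in> alternating_chains P" for C
    using the_inv_into_f_f[OF inj that] by (simp add: a_def)
  have D: "?D = (\<Inter>C\<in>alternating_chains P. H C)"
    unfolding double_order_polytope_eq by (auto simp: H_def)
  have "F facet_of ?D \<longleftrightarrow> (\<exists>h. h \<in> H ` alternating_chains P \<and> F = ?D \<inter> {x. a h \<bullet> x = 1})"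
  proof (rule facet_of_polyhedron_explicit)
    show "finite (H ` alternating_chains P)"
      using finite_alternating_chains by simp
    show "?D = affine hull ?D \<inter> \<Inter> (H ` alternating_chains P)"
      unfolding affine_hull_double_order_polytope using D by simp
    show "a h \<noteq> 0 \<and> h = {x. a h \<bullet> x \<le> 1}" if h: "h \<in> H ` alternating_chains P" for h
    proof -
      obtain C where C: "C \<in> alternating_chains P" "h = H C"
        using h by blast
      have "facet_normal C \<noteq> 0"
        using end_sign_cases[of C] by (auto simp: facet_normal_def zero_prod_def)
      then show ?thesis
        using C a by (simp add: H_def)
    qed
    show "?D \<subset> affine hull ?D \<inter> \<Inter> F'" if "F' \<subset> H ` alternating_chains P" for F'
    proof -
      obtain C where C: "C \<in> alternating_chains P" "H C \<notin> F'"
        using \<open>F' \<subset> H ` alternating_chains P\<close> by blast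
      obtain z where z: "z \<notin> H C" "\<forall>C'\<in>alternating_chains P - {C}. z \<in> H C'"
        using HC[OF C(1)] by blast
      have "z \<in> \<Inter> F'"
        using that C(2) z(2) by blast
      moreover have "z \<notin> ?D"
        using z(1) C(1) unfolding D by blast
      moreover have "?D \<subseteq> \<Inter> F'"
        using that unfolding D by blast
      ultimately show ?thesis
        unfolding affine_hull_double_order_polytope by blast
    qed
  qed
  then show ?thesis
    using a by auto
qed

text \<open>The tight point of a chain lies on its own facet and on no other, so distinct chains
  give distinct facets.\<close>

theorem bij_betw_chains_facets:
  "bij_betw (\<lambda>C. double_order_polytope P \<inter> {x. facet_normal C \<bullet> x = 1})
     (alternating_chains P) {F. F facet_of double_order_polytope P}"
  unfolding bij_betw_def
proof
  show "inj_on (\<lambda>C. double_order_polytope P \<inter> {x. facet_normal C \<bullet> x = 1}) (alternating_chains P)"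
  proof (rule inj_onI, rule ccontr)
    fix C C' assume C: "C \<in> alternating_chains P" "C' \<in> alternating_chains P" "C \<noteq> C'"
      and eq: "double_order_polytope P \<inter> {x. facet_normal C \<bullet> x = 1} =
        double_order_polytope P \<inter> {x. facet_normal C' \<bullet> x = 1}"
    obtain x where x: "facet_normal C \<bullet> x = 1"
        "\<forall>C' \<in> alternating_chains P - {C}. facet_normal C' \<bullet> x < 1"
      using tight_point_exists[OF C(1)] by blast
    then have "facet_normal E \<bullet> x \<le> 1" if "E \<in> alternating_chains P" for E
      using that by (cases "E = C") (auto intro: less_imp_le)
    then have "x \<in> double_order_polytope P"
      by (simp add: double_order_polytope_eq)
    then have "facet_normal C' \<bullet> x = 1"
      using x(1) eq by blast
    then show False
      using x(2) C by force
  qed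
qed (auto simp: facets_double_order_polytope)

section \<open>Rigid linear functions\<close>

text \<open>The inequality of \<open>C\<close> is the sum of two bounds with weights
  \<open>1 + t\<close> and \<open>1 - t\<close>, positive here; equality in the sum forces equality
  in both.\<close>

lemma tight_imp_max_face:
  assumes C: "C \<in> alternating_chains P" and f: "f \<in> order_polytope (P Plus)"
    and g: "g \<in> order_polytope (P Minus)" and t: "- 1 < t" "t < 1"
    and tight: "facet_normal C \<bullet> ((1 + t) *\<^sub>R f - (1 - t) *\<^sub>R g, t) = 1"
  shows "f \<in> max_face (P Plus) (chain_function C)" "g \<in> max_face (P Minus) (- chain_function C)"
proof -
  define s where "s = sign_val (end_sign C)"
  have bf: "chain_function C \<bullet> h \<le> (1 + s) / 2" if "h \<in> order_polytope (P Plus)" for h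
    using chain_function_bound[OF C that] by (simp add: s_def)
  have bg: "- (chain_function C \<bullet> h) \<le> (1 - s) / 2" if "h \<in> order_polytope (P Minus)" for h
    using chain_function_bound[OF C that] by (simp add: s_def)
  have "(1 + t) * (chain_function C \<bullet> f) - (1 - t) * (chain_function C \<bullet> g) - s * t = 1"
    using tight by (simp add: facet_normal_def inner_diff_right s_def)
  then have sum: "(1 + t) * ((1 + s) / 2 - chain_function C \<bullet> f) +
      (1 - t) * ((1 - s) / 2 + chain_function C \<bullet> g) = 0"
    by (simp add: field_simps)
  have nn: "0 \<le> (1 + t) * ((1 + s) / 2 - chain_function C \<bullet> f)"
      "0 \<le> (1 - t) * ((1 - s) / 2 + chain_function C \<bullet> g)"
    using bf[OF f] bg[OF g] t by (intro mult_nonneg_nonneg; linarith)+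
  then have "(1 + t) * ((1 + s) / 2 - chain_function C \<bullet> f) = 0"
      "(1 - t) * ((1 - s) / 2 + chain_function C \<bullet> g) = 0"
    using sum by linarith+
  then have "(1 + s) / 2 - chain_function C \<bullet> f = 0" "(1 - s) / 2 + chain_function C \<bullet> g = 0"
    using t by auto
  then have eq: "chain_function C \<bullet> f = (1 + s) / 2" "- (chain_function C \<bullet> g) = (1 - s) / 2"
    by linarith+
  show "f \<in> max_face (P Plus) (chain_function C)"
    using f bf by (simp add: max_face_def eq)
  show "g \<in> max_face (P Minus) (- chain_function C)"
    using g bg[unfolded eq(2)[symmetric]] by (simp add: max_face_def)
qed

text \<open>The pair of the two whole polytopes serves: they are full-dimensional, so their normal
  cones are \<open>{0}\<close>.\<close>

lemma rigid_zero: "rigid P 0"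
proof -
  have N: "normal_cone (P s) (order_polytope (P s)) = {0}" for s
  proof -
    have "l = 0" if "l \<in> normal_cone (P s) (order_polytope (P s))" for l
      using normal_coneD[OF that] by (intro order_polytope_inner_const_imp_zero[OF partial_order[of s]])
    then show ?thesis
      by (auto simp: normal_cone_def max_face_def)
  qed
  have ne: "order_polytope (P s) \<noteq> {}" for s
    using zero_in_order_polytope by blast
  have "{c *\<^sub>R (0 :: real ^ 'a) | c. 0 < c} = {0}"
    by (auto intro: exI[of _ 1])
  then show ?thesis
    unfolding rigid_def using ne N face_of_refl[OF convex_order_polytope]
    by (intro exI[of _ "order_polytope (P Plus)"] exI[of _ "order_polytope (P Minus)"]) simp
qed

lemma rigid_scale: "0 < c \<Longrightarrow> rigid P (c *\<^sub>R l) \<longleftrightarrow> rigid P l"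
proof -
  assume c: "0 < c"
  have "{d *\<^sub>R c *\<^sub>R l | d. 0 < d} = {d *\<^sub>R l | d. 0 < d}"
  proof safe
    fix d :: real assume "0 < d"
    then show "\<exists>d'. d *\<^sub>R c *\<^sub>R l = d' *\<^sub>R l \<and> 0 < d'" "\<exists>d'. d *\<^sub>R l = d' *\<^sub>R c *\<^sub>R l \<and> 0 < d'"
      using c by (auto intro: exI[of _ "d * c"] exI[of _ "d / c"])
  qed
  then show ?thesis
    by (simp add: rigid_def)
qed

text \<open>Near a point tight for \<open>C\<close> alone, the points of the hyperplane of
  \<open>C\<close> decompose into points of the two maximal faces. As \<open>l\<close> is constant
  on both, a suitable vector extending \<open>l\<close> is constant on this part of the hyperplane,
  hence parallel to its normal.\<close>

lemma normal_cones_chain_parallel: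
  assumes C: "C \<in> alternating_chains P" and nz: "chain_function C \<noteq> 0"
    and l: "l \<in> normal_cone (P Plus) (max_face (P Plus) (chain_function C))"
    and l': "- l \<in> normal_cone (P Minus) (max_face (P Minus) (- chain_function C))"
  shows "\<exists>k. l = k *\<^sub>R chain_function C"
proof -
  let ?F = "max_face (P Plus) (chain_function C)" and ?G = "max_face (P Minus) (- chain_function C)"
  obtain f0 g0 where fg0: "f0 \<in> ?F" "g0 \<in> ?G"
    using max_face_nonempty[OF refl_P] by blast
  define a where "a = facet_normal C"
  \<comment> \<open>The last coordinate is chosen so that the terms in \<open>t\<close> cancel in
    \<open>b \<bullet> z\<close>.\<close>
  define b where "b = (l, - (l \<bullet> g0) - l \<bullet> f0)"
  obtain x e where x: "0 < e" "a \<bullet> x = 1"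
    "\<And>z C'. dist x z < e \<Longrightarrow> C' \<in> alternating_chains P \<Longrightarrow> C' \<noteq> C \<Longrightarrow> facet_normal C' \<bullet> z < 1"
    using tight_ball_exists[OF C] unfolding a_def by metis
  have const: "b \<bullet> z = l \<bullet> f0 - l \<bullet> g0" if z: "dist x z < e" "a \<bullet> z = 1" for z
  proof -
    obtain y t where zeq: "z = (y, t)" by (cases z)
    have "facet_normal E \<bullet> z \<le> 1" if "E \<in> alternating_chains P" for E
      using x(3)[OF z(1) that] z(2) by (cases "E = C") (simp_all add: a_def)
    then have "z \<in> double_order_polytope P"
      by (rule double_order_polytope_sufficient)
    then obtain f g where fg: "f \<in> order_polytope (P Plus)" "g \<in> order_polytope (P Minus)"
        "y = (1 + t) *\<^sub>R f - (1 - t) *\<^sub>R g"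
      unfolding zeq mem_double_order_polytope_iff by auto
    \<comment> \<open>A nonzero chain function excludes the two trivial chains; their strict
      inequalities keep \<open>t\<close> off \<open>\<plusminus>1\<close>, as
      \<open>tight_imp_max_face\<close> requires.\<close>
    have "(s, [Hat0, Hat1]) \<noteq> C" for s
      using nz chain_function_pair by auto
    then have t: "- 1 < t" "t < 1"
      using x(3)[OF z(1) trivial_chain[of Plus]] x(3)[OF z(1) trivial_chain[of Minus]]
      by (auto simp: facet_normal_trivial zeq)
    have "f \<in> ?F" "g \<in> ?G"
      using tight_imp_max_face[OF C fg(1,2) t] z(2) by (auto simp: zeq fg(3) a_def)
    then have "l \<bullet> f = l \<bullet> f0" "l \<bullet> g = l \<bullet> g0"
      using normal_coneD(2)[OF l _ fg(1), of f0] normal_coneD(2)[OF l, of f f0]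
        normal_coneD(2)[OF l' _ fg(2), of g0] normal_coneD(2)[OF l', of g g0]
        normal_coneD(1)[OF l fg0(1)] normal_coneD(1)[OF l' fg0(2)] fg0
      by simp_all
    then show ?thesis
      by (simp add: b_def zeq fg(3) inner_diff_right algebra_simps)
  qed
  have "b \<bullet> d = 0" if d: "a \<bullet> d = 0" for d
  proof (cases "d = 0")
    case False
    define q where "q = e / (2 * norm d)"
    have q: "0 < q"
      using False x(1) by (simp add: q_def)
    have "dist x (x + q *\<^sub>R d) < e"
      using False x(1) by (simp add: q_def dist_norm)
    moreover have "a \<bullet> (x + q *\<^sub>R d) = 1"
      using d x(2) by (simp add: inner_add_right)
    ultimately have "b \<bullet> (x + q *\<^sub>R d) = b \<bullet> x"
      using const[of "x + q *\<^sub>R d"] const[of x] x(1,2) by simp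
    then show ?thesis
      using q by (simp add: inner_add_right)
  qed simp
  then obtain k where "b = k *\<^sub>R a"
    using parallel_if_orthogonal_subset by blast
  then have "l = k *\<^sub>R chain_function C"
    by (simp add: a_def b_def facet_normal_def)
  then show ?thesis ..
qed

lemma rigid_chain_function:
  assumes C: "C \<in> alternating_chains P"
  shows "rigid P (chain_function C)"
proof (cases "chain_function C = 0")
  case True
  then show ?thesis
    using rigid_zero by simp
next
  case nz: False
  define m where "m = chain_function C"
  let ?F = "max_face (P Plus) m" and ?G = "max_face (P Minus) (- m)"
  let ?N = "normal_cone (P Plus) ?F" and ?N' = "normal_cone (P Minus) ?G"
  have "rel_interior ?N \<inter> rel_interior (uminus ` ?N') = {c *\<^sub>R m | c. c > 0}"
  proof (intro equalityI subsetI)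
    fix l assume "l \<in> rel_interior ?N \<inter> rel_interior (uminus ` ?N')"
    then have l: "l \<in> rel_interior ?N" "- l \<in> rel_interior ?N'"
      by (auto simp: rel_interior_uminus_image)
    then have "l \<in> ?N" "- l \<in> ?N'"
      using rel_interior_subset by blast+
    then obtain k where k: "l = k *\<^sub>R m"
      using normal_cones_chain_parallel[OF C nz] unfolding m_def by blast
    have m: "m \<in> ?N"
      by (simp add: normal_cone_def)
    \<comment> \<open>Otherwise the segment from \<open>m\<close> through the relative interior
      point \<open>l\<close> could be prolonged inside the cone to a negative multiple of
      \<open>m\<close>, and \<open>m\<close> would be constant on the whole polytope.\<close>
    have "0 < k"
    proof (rule ccontr)
      assume "\<not> 0 < k"
      obtain e where e: "e > 1" "(1 - e) *\<^sub>R m + e *\<^sub>R l \<in> ?N"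
        using convex_rel_interior_iff[OF convex_normal_cone, of "P Plus" ?F l] l(1) m by blast
      define d where "d = 1 - e + e * k"
      have "e * k \<le> 0"
        using e \<open>\<not> 0 < k\<close> by (simp add: mult_nonneg_nonpos)
      then have d: "d < 0"
        using e(1) by (simp add: d_def)
      have dN: "d *\<^sub>R m \<in> ?N"
        using e(2) by (simp add: d_def k scaleR_add_left)
      obtain f where f: "f \<in> ?F"
        using max_face_nonempty[OF refl_P] by blast
      have "m \<bullet> g = m \<bullet> f" if "g \<in> order_polytope (P Plus)" for g
        using normal_coneD(2)[OF m f that] normal_coneD(2)[OF dN f that] d
        by (simp add: mult_le_cancel_left)
      then have "m = 0"
        by (intro order_polytope_inner_const_imp_zero[OF partial_order[of Plus]]) simp
      then show False
        using nz by (simp add: m_def)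
    qed
    then show "l \<in> {c *\<^sub>R m | c. c > 0}"
      using k by blast
  next
    fix l assume "l \<in> {c *\<^sub>R m | c. c > 0}"
    then obtain c where c: "l = c *\<^sub>R m" "c > 0"
      by blast
    have "max_face r (c *\<^sub>R k) = max_face r k" for r and k :: "real ^ 'a"
      using c(2) by (simp add: max_face_def)
    then have "max_face (P Plus) l = ?F" "max_face (P Minus) (- l) = ?G"
      using c(1) scaleR_minus_right[of c m] by metis+
    then have "l \<in> rel_interior ?N" "- l \<in> rel_interior ?N'"
      using rel_interior_normal_cone_max_face[OF refl_P] by metis+
    then show "l \<in> rel_interior ?N \<inter> rel_interior (uminus ` ?N')"
      by (simp add: rel_interior_uminus_image)
  qed
  then show ?thesis
    unfolding rigid_def m_def[symmetric]
    by (intro exI[of _ ?F] exI[of _ ?G] conjI max_face_face_of max_face_nonempty refl_P)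
qed

lemma rigid_imp_chain:
  assumes "rigid P l"
  shows "\<exists>C \<in> alternating_chains P. \<exists>c > 0. l = c *\<^sub>R chain_function C"
proof (cases "l = 0")
  case True
  then have "l = 1 *\<^sub>R chain_function (Plus, [Hat0, Hat1])"
    by (simp add: chain_function_pair)
  then show ?thesis
    using trivial_chain zero_less_one by blast
next
  case nz: False
  obtain F G where FG: "F face_of order_polytope (P Plus)" "F \<noteq> {}"
      "G face_of order_polytope (P Minus)" "G \<noteq> {}"
    and ray: "rel_interior (normal_cone (P Plus) F) \<inter>
        rel_interior (uminus ` normal_cone (P Minus) G) = {c *\<^sub>R l | c. c > 0}"
    using assms by (auto simp: rigid_def)
  have ray_iff: "k \<in> rel_interior (normal_cone (P Plus) F) \<and>
      - k \<in> rel_interior (normal_cone (P Minus) G) \<longleftrightarrow> (\<exists>c>0. k = c *\<^sub>R l)" for k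
    using ray by (auto simp: rel_interior_uminus_image set_eq_iff)
  have l: "l \<in> rel_interior (normal_cone (P Plus) F)" "- l \<in> rel_interior (normal_cone (P Minus) G)"
    using ray_iff[of l] by (auto intro: exI[of _ 1])
  then have lN: "l \<in> normal_cone (P Plus) F" "- l \<in> normal_cone (P Minus) G"
    using rel_interior_subset by blast+
  obtain f g where fg: "f \<in> rel_interior F" "g \<in> rel_interior G"
    using FG(2,4) rel_interior_eq_empty[OF face_of_imp_convex[OF FG(1)]]
      rel_interior_eq_empty[OF face_of_imp_convex[OF FG(3)]] by auto
  then have fg': "f \<in> F" "g \<in> G"
    using rel_interior_subset by blast+
  note fgO = normal_coneD(1)[OF lN(1) fg'(1)] normal_coneD(1)[OF lN(2) fg'(2)]
  \<comment> \<open>The slice at height \<open>0\<close> consists of the differences of points of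
    the two order polytopes.\<close>
  have "(f - g, 0) \<in> double_order_polytope P"
    unfolding mem_double_order_polytope_iff using fgO by auto
  then have le1: "facet_normal C \<bullet> (f - g, 0) \<le> 1" if "C \<in> alternating_chains P" for C
    using that double_order_polytope_inequality by blast
  \<comment> \<open>Otherwise a small step in direction \<open>l\<close> stays in the polytope and
    raises \<open>l\<close> above its value at \<open>f - g\<close>, although \<open>l\<close> is
    maximal at \<open>f\<close> and minimal at \<open>g\<close>.\<close>
  have "\<exists>C \<in> alternating_chains P. facet_normal C \<bullet> (f - g, 0) = 1"
  proof (rule ccontr)
    define U where "U = (\<Inter>C\<in>alternating_chains P. {z. facet_normal C \<bullet> z < 1})"
    assume "\<not> ?thesis"
    then have "(f - g, 0) \<in> U"
      using le1 by (force simp: U_def)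
    moreover have "open U"
      unfolding U_def using finite_alternating_chains by (intro open_INT ballI open_halfspace_lt) auto
    ultimately obtain e where e: "0 < e" "ball (f - g, 0) e \<subseteq> U"
      using open_contains_ball by blast
    define q where "q = e / (2 * norm l)"
    have q: "0 < q"
      using nz e by (simp add: q_def)
    have "dist (f - g, 0) (f - g + q *\<^sub>R l, 0 :: real) < e"
      using nz e by (simp add: q_def dist_prod_def dist_norm)
    then have "(f - g + q *\<^sub>R l, 0) \<in> U"
      using e(2) by auto
    then have "(f - g + q *\<^sub>R l, 0) \<in> double_order_polytope P"
      by (auto simp: U_def double_order_polytope_eq intro: less_imp_le)
    then obtain f' g' where fg2: "f' \<in> order_polytope (P Plus)" "g' \<in> order_polytope (P Minus)"
        "f - g + q *\<^sub>R l = f' - g'"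
      unfolding mem_double_order_polytope_iff by auto
    have "l \<bullet> f' \<le> l \<bullet> f" "- l \<bullet> g' \<le> - l \<bullet> g"
      using normal_coneD(2)[OF lN(1) fg'(1) fg2(1)] normal_coneD(2)[OF lN(2) fg'(2) fg2(2)] by auto
    then have "l \<bullet> (f' - g') \<le> l \<bullet> (f - g)"
      by (simp add: inner_diff_right)
    moreover have "l \<bullet> (f' - g') = l \<bullet> (f - g) + q * (l \<bullet> l)"
      unfolding fg2(3)[symmetric] by (simp add: inner_add_right)
    ultimately have "q * (l \<bullet> l) \<le> 0"
      by simp
    then show False
      using q nz by (metis inner_gt_zero_iff mult_pos_pos not_le)
  qed
  then obtain C where C: "C \<in> alternating_chains P" and tight: "facet_normal C \<bullet> (f - g, 0) = 1"
    by blast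
  define m where "m = chain_function C"
  have mx: "f \<in> max_face (P Plus) m" "g \<in> max_face (P Minus) (- m)"
    using tight_imp_max_face[OF C fgO, of 0] tight by (auto simp: m_def)
  \<comment> \<open>A face containing a relative interior point of \<open>F\<close> contains all of
    \<open>F\<close>.\<close>
  have "F \<subseteq> max_face (P Plus) m"
    using mx(1) fg(1)
    by (intro subset_of_face_of[OF max_face_face_of[OF refl_P] face_of_imp_subset[OF FG(1)]]) blast
  moreover have "G \<subseteq> max_face (P Minus) (- m)"
    using mx(2) fg(2)
    by (intro subset_of_face_of[OF max_face_face_of[OF refl_P] face_of_imp_subset[OF FG(3)]]) blast
  ultimately have mN: "m \<in> normal_cone (P Plus) F" "- m \<in> normal_cone (P Minus) G"
    by (simp_all add: normal_cone_def)
  \<comment> \<open>The midpoint of \<open>m\<close> and \<open>l\<close>, negated for the second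
    cone, stays in the relative interiors and hence on the ray of \<open>l\<close>. So
    \<open>m\<close> is a multiple of \<open>l\<close>, at first of unknown sign.\<close>
  have "m - (1 / 2) *\<^sub>R (m - l) \<in> rel_interior (normal_cone (P Plus) F)"
    using rel_interior_convex_shrink[OF convex_normal_cone l(1) mN(1), of "1 / 2"] by simp
  moreover have "- m - (1 / 2) *\<^sub>R (- m - - l) \<in> rel_interior (normal_cone (P Minus) G)"
    using rel_interior_convex_shrink[OF convex_normal_cone l(2) mN(2), of "1 / 2"] by simp
  moreover have "- m - (1 / 2) *\<^sub>R (- m - - l) = - (m - (1 / 2) *\<^sub>R (m - l))"
    by (simp add: algebra_simps)
  ultimately obtain c where c: "m - (1 / 2) *\<^sub>R (m - l) = c *\<^sub>R l"
    using ray_iff by metis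
  define d where "d = 2 * c - 1"
  have "2 *\<^sub>R (m - (1 / 2) *\<^sub>R (m - l)) = l + m"
    by (simp add: scaleR_diff_right scaleR_2)
  then have "l + m = (2 * c) *\<^sub>R l"
    using c by simp
  then have md: "m = d *\<^sub>R l"
    by (metis add_diff_cancel_left' d_def scaleR_diff_left scaleR_one)
  \<comment> \<open>As \<open>0\<close> belongs to both order polytopes, \<open>l\<close> is
    nonnegative at \<open>f - g\<close>; tightness at height \<open>0\<close> then forces
    \<open>d\<close> to be positive.\<close>
  have "0 \<le> l \<bullet> f" "0 \<le> - l \<bullet> g"
    using normal_coneD(2)[OF lN(1) fg'(1) zero_in_order_polytope]
      normal_coneD(2)[OF lN(2) fg'(2) zero_in_order_polytope] by auto
  then have "0 \<le> l \<bullet> (f - g)"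
    by (simp add: inner_diff_right)
  moreover have "d * (l \<bullet> (f - g)) = 1"
    using tight md by (simp add: facet_normal_def m_def)
  ultimately have "0 < d"
    using mult_nonpos_nonneg[of d "l \<bullet> (f - g)"] by linarith
  then have "l = (1 / d) *\<^sub>R chain_function C" "0 < 1 / d"
    using md by (simp_all add: m_def)
  then show ?thesis
    using C by blast
qed

end

theorem theorem2p7:
  fixes P :: "'a::finite double_poset"
  assumes "double_poset P"
    and "compatible P"
  shows "(\<forall>l. rigid P l \<longleftrightarrow>
            (\<exists>C \<in> alternating_chains P. \<exists>c > 0. l = c *\<^sub>R chain_function C)) \<and>
         (\<exists>\<phi>. bij_betw \<phi> (alternating_chains P) {F. F facet_of double_order_polytope P})"
proof -
  interpret compatible_double_poset P
    using assms by unfold_locales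
  show ?thesis
    using rigid_imp_chain rigid_chain_function rigid_scale bij_betw_chains_facets by blast
qed

end
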